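(* Let $\mathbf{A}$ be a finite set of non-zero vectors in $\mathbb{R}^n$, all contained in an open halfspace bounded by a linear hyperplane. If the poset of regions $\mathcal{R}_{\mathbf{A}}$ is a lattice, then $\mathbf{A}$ fulfills the following conditions: (1) for any linear hyperplane $H$ of $\mathbb{R}^n$, the cone generated by the vectors of $\mathbf{A}\cap H$ is simplicial; (2) for any $d$-dimensional face $F$ of the zonotope $\mathbb{Z}_{\mathbf{A}}$, the source of $F$ in $\mathcal{R}_{\mathbf{A}}$ has degree $d$ in $F$.
   Context: Let $\mathcal{H}_{\mathbf{A}}$ be the arrangement of the hyperplanes $\{x\in\mathbb{R}^n : \langle x,a\rangle=0\}$ for $a\in\mathbf{A}$, and let the zonotope $\mathbb{Z}_{\mathbf{A}}$ be the Minkowski sum of the segments $[-a,a]$ for $a\in\mathbf{A}$. The regions of $\mathcal{H}_{\mathbf{A}}$ are the (closures of the) connected components of the complement of its hyperplanes; they are in bijection with the vertices of $\mathbb{Z}_{\mathbf{A}}$ (the region being the normal cone of the vertex). The positive set of a region $R$ is the set of $a\in\mathbf{A}$ such that $R$ lies in the halfspace $\langle x,a\rangle\ge0$. The base region is the region on the negative side of all vectors of $\mathbf{A}$. The poset of regions $\mathcal{R}_{\mathbf{A}}$ is the set of regions of $\mathcal{H}_{\mathbf{A}}$ ordered by inclusion of positive sets; its Hasse diagram is the graph of $\mathbb{Z}_{\mathbf{A}}$ oriented in the direction $\sum_{a\in\mathbf{A}}a$. A cone is simplicial if it is generated by linearly independent vectors. The source of a face $F$ of $\mathbb{Z}_{\mathbf{A}}$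 is the vertex of $F$ that is minimal in $\mathcal{R}_{\mathbf{A}}$ among the vertices of $F$, and its degree in $F$ is the number of edges of $F$ containing it. *)

theory Defs
  imports "HOL-Analysis.Analysis" "HOL-Algebra.Lattice"
begin

definition linear_hyperplane :: "'a::euclidean_space set \<Rightarrow> bool" where
  "linear_hyperplane H \<longleftrightarrow> (\<exists>c. c \<noteq> 0 \<and> H = {x. x \<bullet> c = 0})"

definition in_open_halfspace :: "'a::euclidean_space set \<Rightarrow> bool" where
  "in_open_halfspace A \<longleftrightarrow> (\<exists>c. c \<noteq> 0 \<and> A \<subseteq> {x. x \<bullet> c > 0})"

text \<open>The convex cone generated by the empty set is \<open>{0}\<close>, which counts as simplicial.\<close>

definition simplicial_cone :: "'a::euclidean_space set \<Rightarrow> bool" where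
  "simplicial_cone C \<longleftrightarrow> (\<exists>B. independent B \<and> C = convex_cone hull B)"

definition arrangement :: "'a::euclidean_space set \<Rightarrow> 'a set set" where
  "arrangement A = (\<lambda>a. {x. x \<bullet> a = 0}) ` A"

definition regions :: "'a::euclidean_space set \<Rightarrow> 'a set set" where
  "regions A = closure ` components (- \<Union>(arrangement A))"

definition positive_set :: "'a::euclidean_space set \<Rightarrow> 'a set \<Rightarrow> 'a set" where
  "positive_set A R = {a \<in> A. R \<subseteq> {x. x \<bullet> a \<ge> 0}}"

definition poset_of_regions :: "'a::euclidean_space set \<Rightarrow> 'a set gorder" where
  "poset_of_regions A =
     \<lparr>carrier = regions A, eq = (=), le = (\<lambda>R S. positive_set A R \<subseteq> positive_set A S)\<rparr>"

text \<open>Minkowski sum, i.e. the sum of sets from \<^theory>\<open>HOL-Library.Set_Algebras\<close>;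
  only meaningful for finite \<open>A\<close>.\<close>

definition zonotope :: "'a::euclidean_space set \<Rightarrow> 'a set" where
  "zonotope A = (\<Sum>a\<in>A. closed_segment (- a) a)"

text \<open>Outer normal cone; the vertex \<open>- \<Sum>A\<close> thus corresponds to the base region.\<close>

definition normal_cone :: "'a::euclidean_space set \<Rightarrow> 'a \<Rightarrow> 'a set" where
  "normal_cone P v = {x. \<forall>y\<in>P. x \<bullet> y \<le> x \<bullet> v}"

text \<open>A vertex of the zonotope is compared in the poset of regions through the region that
  corresponds to it, namely its normal cone with respect to the whole zonotope (not with
  respect to the face). The vertices of a non-empty face have exactly one minimal element
  when \<open>A\<close> is finite, does not contain 0 and lies in an open halfspace, so that the definite
  description is well defined.\<close>

definition source :: "'a::euclidean_space set \<Rightarrow> 'a set \<Rightarrow> 'a" where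
  "source A F = (THE v. v extreme_point_of F \<and>
     \<not> (\<exists>w. w extreme_point_of F \<and>
           normal_cone (zonotope A) w \<sqsubset>\<^bsub>poset_of_regions A\<^esub> normal_cone (zonotope A) v))"

definition degree_in :: "'a::euclidean_space set \<Rightarrow> 'a \<Rightarrow> nat" where
  "degree_in F v = card {e. e edge_of F \<and> v \<in> e}"

end

theory Submission
  imports Defs
begin

text \<open>
  Fix \<open>c\<close> and let \<open>A\<^sub>c\<close> be the set of vectors of \<open>A\<close> orthogonal to \<open>c\<close>. Choose a minimal set \<open>B \<subseteq> A\<^sub>c\<close>
  of generators of the cone of \<open>A\<^sub>c\<close>, and suppose that \<open>\<Sum>b\<in>B. u b *\<^sub>R b = 0\<close> with \<open>u\<close> not identically
  zero; let \<open>I\<close> and \<open>J\<close> be the sets where \<open>u\<close> is positive and negative. Near \<open>c\<close> there are regions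
  \<open>L\<^sub>b\<close> and \<open>U\<^sub>b\<close> for which the positive vectors of \<open>A\<^sub>c\<close> are those on the ray of \<open>b\<close>, respectively those
  off that ray. Then \<open>L\<^sub>i \<le> U\<^sub>j\<close> for \<open>i \<in> I\<close>, \<open>j \<in> J\<close>, so the join of the \<open>L\<^sub>i\<close> is positive on \<open>I\<close>
  and negative on \<open>J\<close>, which contradicts the linear relation. Hence \<open>B\<close> is independent.

  A face of the zonotope maximizes some linear functional \<open>c\<close>. Its source \<open>s\<close> has coefficient \<open>-1\<close> at
  every vector of \<open>A\<^sub>c\<close>, the face lies in \<open>s\<close> plus the cone of \<open>A\<^sub>c\<close> and contains \<open>s + 2 *\<^sub>R b\<close> for
  \<open>b \<in> B\<close>. So the edges at \<open>s\<close> correspond to the elements of \<open>B\<close>, whose number is the dimension.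
\<close>

section \<open>Finitely generated cones and their extreme rays\<close>

lemma convex_cone_hull_finite_sum:
  fixes B :: "'a::real_vector set"
  assumes "finite B" "x \<in> convex_cone hull B"
  shows "\<exists>t. (\<forall>b\<in>B. 0 \<le> t b) \<and> x = (\<Sum>b\<in>B. t b *\<^sub>R b)"
proof -
  let ?T = "{x. \<exists>t. (\<forall>b\<in>B. 0 \<le> t b) \<and> x = (\<Sum>b\<in>B. t b *\<^sub>R b)}"
  have "convex_cone hull B \<subseteq> ?T"
  proof (rule hull_minimal)
    show "B \<subseteq> ?T"
    proof
      fix b assume "b \<in> B"
      then have "b = (\<Sum>b'\<in>B. (if b' = b then 1 else 0) *\<^sub>R b')"
        using assms(1) by (simp add: if_distrib[of "\<lambda>r. r *\<^sub>R _"] cong: if_cong)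
      then show "b \<in> ?T"
        by (intro CollectI exI[of _ "\<lambda>b'. if b' = b then 1 else 0"]) auto
    qed
    show "convex_cone ?T"
      unfolding convex_cone_iff
    proof (intro conjI ballI allI impI)
      show "0 \<in> ?T" by (intro CollectI exI[of _ "\<lambda>_. 0"]) auto
    next
      fix x y assume "x \<in> ?T" "y \<in> ?T"
      then obtain t t' where
        "\<forall>b\<in>B. 0 \<le> t b" "x = (\<Sum>b\<in>B. t b *\<^sub>R b)"
        "\<forall>b\<in>B. 0 \<le> t' b" "y = (\<Sum>b\<in>B. t' b *\<^sub>R b)" by blast
      then show "x + y \<in> ?T"
        by (intro CollectI exI[of _ "\<lambda>b. t b + t' b"]) (auto simp: scaleR_add_left sum.distrib)
    next
      fix x and r :: real assume "x \<in> ?T" "0 \<le> r"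
      then obtain t where "\<forall>b\<in>B. 0 \<le> t b" "x = (\<Sum>b\<in>B. t b *\<^sub>R b)" by blast
      with \<open>0 \<le> r\<close> show "r *\<^sub>R x \<in> ?T"
        by (intro CollectI exI[of _ "\<lambda>b. r * t b"]) (auto simp: scaleR_sum_right)
    qed
  qed
  with assms(2) show ?thesis by auto
qed

text \<open>A generator lying in the cone of the others could be dropped, so an inclusion-minimal
  generating subset is irredundant. In a pointed cone this makes each remaining vector span an
  extreme ray.\<close>

lemma minimal_cone_generators:
  assumes "finite A"
  obtains B where "B \<subseteq> A" "convex_cone hull B = convex_cone hull A"
    "\<And>b. b \<in> B \<Longrightarrow> b \<notin> convex_cone hull (B - {b})"
proof -
  let ?\<B> = "{B. B \<subseteq> A \<and> convex_cone hull B = convex_cone hull A}"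
  have "finite ?\<B>" using assms by simp
  moreover have "A \<in> ?\<B>" by simp
  ultimately obtain B where B: "B \<in> ?\<B>" and min: "\<And>B'. B' \<in> ?\<B> \<Longrightarrow> B' \<subseteq> B \<Longrightarrow> B = B'"
    by (metis (no_types, lifting) finite_has_minimal2)
  have "b \<notin> convex_cone hull (B - {b})" if "b \<in> B" for b
  proof
    assume "b \<in> convex_cone hull (B - {b})"
    then have "B \<subseteq> convex_cone hull (B - {b})"
      using hull_subset[of "B - {b}" convex_cone] by blast
    then have "convex_cone hull B \<subseteq> convex_cone hull (B - {b})"
      by (simp add: hull_minimal convex_cone_convex_cone_hull)
    then have "convex_cone hull (B - {b}) = convex_cone hull B"
      using hull_mono[of "B - {b}" B convex_cone] by auto
    then have "B - {b} \<in> ?\<B>" using B by auto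
    then show False using min[of "B - {b}"] that by blast
  qed
  then show thesis using that B by blast
qed

text \<open>Since \<open>h\<close> is positive, the convex hull of \<open>B\<close> is compact and
  misses the line through \<open>b0\<close>. Strict separation gives \<open>w\<close>, which must
  vanish on the line because it is bounded below there.\<close>

lemma extreme_ray_functional:
  fixes B :: "'a::euclidean_space set"
  assumes "finite B" "\<And>b. b \<in> B \<Longrightarrow> 0 < h \<bullet> b" "0 < h \<bullet> b0" "b0 \<notin> convex_cone hull B"
  obtains w where "w \<bullet> b0 = 0" "\<And>b. b \<in> B \<Longrightarrow> 0 < w \<bullet> b"
proof (cases "B = {}")
  case True
  then show thesis using that[of 0] by simp
next
  case False
  have "convex hull B \<subseteq> {x. h \<bullet> x > 0}"
    by (rule hull_minimal) (auto simp: assms convex_halfspace_gt)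
  \<comment> \<open>A multiple \<open>k *\<^sub>R b0\<close> in the hull has \<open>0 < k\<close> by
    positivity of \<open>h\<close>, and rescaling it would put \<open>b0\<close> into the cone of
    \<open>B\<close>.\<close>
  have disj: "convex hull B \<inter> span {b0} = {}"
  proof (rule ccontr)
    assume "convex hull B \<inter> span {b0} \<noteq> {}"
    then obtain k where k: "k *\<^sub>R b0 \<in> convex hull B" by (auto simp: span_singleton)
    with \<open>convex hull B \<subseteq> {x. h \<bullet> x > 0}\<close> have "0 < k * (h \<bullet> b0)" by auto
    then have "0 < k" using assms(3) by (simp add: zero_less_mult_iff)
    have "(1 / k) *\<^sub>R (k *\<^sub>R b0) \<in> convex_cone hull B"
      using convex_cone_hull_mul[OF subsetD[OF convex_hull_subset_convex_cone_hull k], of "1 / k"]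
        \<open>0 < k\<close>
      by simp
    then show False using \<open>0 < k\<close> assms(4) by simp
  qed
  obtain w d where w: "\<forall>x\<in>convex hull B. w \<bullet> x < d" "\<forall>x\<in>span {b0}. d < w \<bullet> x"
    using separating_hyperplane_compact_closed[of "convex hull B" "span {b0}"] disj False assms(1)
    by (auto simp: finite_imp_compact_convex_hull closed_subspace subspace_imp_convex)
  have "d < 0" using w(2) span_zero[of "{b0}"] by fastforce
  have "w \<bullet> b0 = 0"
  proof (rule ccontr)
    assume "w \<bullet> b0 \<noteq> 0"
    \<comment> \<open>This multiple of \<open>b0\<close> takes exactly the value \<open>d\<close>,
      contrary to the strict bound on the line.\<close>
    have "d < w \<bullet> ((d / (w \<bullet> b0)) *\<^sub>R b0)"
      by (rule bspec[OF w(2)]) (intro span_scale span_base, simp)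
    then show False using \<open>w \<bullet> b0 \<noteq> 0\<close> by simp
  qed
  moreover have "0 < (- w) \<bullet> b" if "b \<in> B" for b
    using w(1) \<open>d < 0\<close> that hull_inc[of b B convex] by fastforce
  ultimately show thesis using that[of "- w"] by simp
qed

text \<open>On a nonnegative combination of \<open>B\<close>, all terms of \<open>w b\<close> are
  nonnegative, and a generator other than \<open>b\<close> with non-zero coefficient contributes a
  positive one. So \<open>w b\<close> supports the cone exactly along the ray of
  \<open>b\<close>.\<close>

lemma extreme_ray_functionals:
  fixes B :: "'a::euclidean_space set"
  assumes fin: "finite B" and h: "\<And>b. b \<in> B \<Longrightarrow> 0 < h \<bullet> b"
    and min: "\<And>b. b \<in> B \<Longrightarrow> b \<notin> convex_cone hull (B - {b})"
  obtains w where "\<forall>b\<in>B. w b \<bullet> b = 0 \<and> (\<forall>b'\<in>B. b' \<noteq> b \<longrightarrow> 0 < w b \<bullet> b') \<and>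
    (\<forall>x\<in>convex_cone hull B. 0 \<le> w b \<bullet> x \<and> (w b \<bullet> x = 0 \<longrightarrow> (\<exists>k\<ge>0. x = k *\<^sub>R b)))"
proof -
  have "\<exists>w. w \<bullet> b = 0 \<and> (\<forall>b'\<in>B - {b}. 0 < w \<bullet> b')" if "b \<in> B" for b
    by (rule extreme_ray_functional[of "B - {b}" h b]) (use that h fin min in auto)
  then obtain w where w: "\<And>b. b \<in> B \<Longrightarrow> w b \<bullet> b = 0"
    and w': "\<And>b b'. b \<in> B \<Longrightarrow> b' \<in> B \<Longrightarrow> b' \<noteq> b \<Longrightarrow> 0 < w b \<bullet> b'"
    by (metis Diff_iff singletonD)
  have nn: "0 \<le> w b \<bullet> b'" if "b \<in> B" "b' \<in> B" for b b'
    using w w' that by (metis less_eq_real_def)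
  have "0 \<le> w b \<bullet> x" if "b \<in> B" "x \<in> convex_cone hull B" for b x
  proof -
    obtain t where "\<forall>b\<in>B. 0 \<le> t b" "x = (\<Sum>b\<in>B. t b *\<^sub>R b)"
      using convex_cone_hull_finite_sum[OF fin \<open>x \<in> _\<close>] by blast
    then show ?thesis using nn[OF that(1)] by (auto simp: inner_sum_right intro!: sum_nonneg)
  qed
  moreover have "\<exists>k\<ge>0. x = k *\<^sub>R b"
    if "b \<in> B" "x \<in> convex_cone hull B" "w b \<bullet> x = 0" for b x
  proof -
    obtain t where t: "\<forall>b\<in>B. 0 \<le> t b" "x = (\<Sum>b\<in>B. t b *\<^sub>R b)"
      using convex_cone_hull_finite_sum[OF fin \<open>x \<in> _\<close>] by blast
    have "(\<Sum>b'\<in>B. t b' * (w b \<bullet> b')) = 0"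
      using that(3) t(2) by (simp add: inner_sum_right)
    then have "\<forall>b'\<in>B. t b' * (w b \<bullet> b') = 0"
      using sum_nonneg_eq_0_iff[OF fin, of "\<lambda>b'. t b' * (w b \<bullet> b')"] nn[OF that(1)] t(1) by simp
    then have "t b' = 0" if "b' \<in> B - {b}" for b' using w' that \<open>b \<in> B\<close> by force
    then have "(\<Sum>b'\<in>B. t b' *\<^sub>R b') = t b *\<^sub>R b"
      using sum.remove[OF fin \<open>b \<in> B\<close>, of "\<lambda>b'. t b' *\<^sub>R b'"] by simp
    then show ?thesis using t \<open>b \<in> B\<close> by auto
  qed
  ultimately show thesis using that[of w] w w' by simp
qed

section \<open>Generic points and the positive sets of regions\<close>

text \<open>The witness is \<open>u + e *\<^sub>R v\<close> for small \<open>e > 0\<close>: signs of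
  \<open>u\<close> persist where they are non-zero, and \<open>v\<close> breaks the ties. Finiteness
  of \<open>A\<close> allows one \<open>e\<close> for all vectors.\<close>

lemma lexicographic_perturbation:
  fixes u v :: "'a::real_inner"
  assumes "finite A"
  obtains z where "\<And>a. a \<in> A \<Longrightarrow> sgn (z \<bullet> a) = (if u \<bullet> a = 0 then sgn (v \<bullet> a) else sgn (u \<bullet> a))"
proof -
  have "\<forall>\<^sub>F e in at_right 0. \<forall>a\<in>A. sgn ((u + e *\<^sub>R v) \<bullet> a) =
          (if u \<bullet> a = 0 then sgn (v \<bullet> a) else sgn (u \<bullet> a))"
  proof (intro eventually_ball_finite[OF assms] ballI)
    fix a
    have lim: "((\<lambda>e. (u + e *\<^sub>R v) \<bullet> a) \<longlongrightarrow> u \<bullet> a) (at_right 0)"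
      by (auto intro!: tendsto_eq_intros)
    consider "u \<bullet> a = 0" | "u \<bullet> a > 0" | "u \<bullet> a < 0" by linarith
    then show "\<forall>\<^sub>F e in at_right 0. sgn ((u + e *\<^sub>R v) \<bullet> a) =
        (if u \<bullet> a = 0 then sgn (v \<bullet> a) else sgn (u \<bullet> a))"
    proof cases
      case 1
      then show ?thesis
        by (auto simp: inner_add_left sgn_mult intro: eventually_mono[OF eventually_at_right_less])
    next
      case 2
      then show ?thesis
        using order_tendstoD(1)[OF lim 2] by (auto elim: eventually_mono)
    next
      case 3
      then show ?thesis
        using order_tendstoD(2)[OF lim 3] by (auto elim: eventually_mono)
    qed
  qed
  then obtain e where "\<forall>a\<in>A. sgn ((u + e *\<^sub>R v) \<bullet> a) =
          (if u \<bullet> a = 0 then sgn (v \<bullet> a) else sgn (u \<bullet> a))"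
    using eventually_happens by force
  then show thesis using that by blast
qed

text \<open>A component is connected and avoids every hyperplane, so each sign is constant on it.
  The closure keeps the weak inequality, and \<open>y\<close> itself recovers the strict
  one.\<close>

lemma positive_set_closure_component:
  assumes "C \<in> components (- \<Union>(arrangement A))" "y \<in> C"
  shows "positive_set A (closure C) = {a \<in> A. 0 < y \<bullet> a}"
proof -
  have nz: "z \<bullet> a \<noteq> 0" if "a \<in> A" "z \<in> C" for z a
    using in_components_subset[OF assms(1)] that by (auto simp: arrangement_def)
  have "closure C \<subseteq> {x. 0 \<le> x \<bullet> a}" if "a \<in> A" "0 < y \<bullet> a" for a
  proof -
    have "C \<subseteq> {x. 0 \<le> x \<bullet> a}"
    proof (rule ccontr)
      assume "\<not> C \<subseteq> {x. 0 \<le> x \<bullet> a}"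
      then obtain z where "z \<in> C" "z \<bullet> a < 0" by force
      then show False
        using connected_ivt_hyperplane[OF in_components_connected[OF assms(1)], of z y a 0]
          assms(2) nz that by (force simp: inner_commute)
    qed
    moreover have "closed {x. 0 \<le> x \<bullet> a}"
      using closed_halfspace_ge[of 0 a] by (simp add: inner_commute)
    ultimately show ?thesis by (rule closure_minimal)
  qed
  moreover have "0 < y \<bullet> a" if "a \<in> A" "closure C \<subseteq> {x. 0 \<le> x \<bullet> a}" for a
    using that nz[OF that(1) assms(2)] assms(2) closure_subset[of C] by force
  ultimately show ?thesis by (auto simp: positive_set_def)
qed

text \<open>Together with \<open>generic_of_region\<close>, this replaces regions by points off all
  hyperplanes, compared through their signs.\<close>

lemma region_of_generic:
  assumes "\<And>a. a \<in> A \<Longrightarrow> y \<bullet> a \<noteq> 0"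
  obtains R where "R \<in> regions A" "positive_set A R = {a \<in> A. 0 < y \<bullet> a}"
proof -
  have "y \<in> - \<Union>(arrangement A)" using assms by (auto simp: arrangement_def)
  then obtain C where "C \<in> components (- \<Union>(arrangement A))" "y \<in> C"
    by (metis UnionE Union_components)
  then show thesis
    using that[of "closure C"] positive_set_closure_component by (auto simp: regions_def)
qed

lemma generic_of_region:
  assumes "R \<in> regions A"
  obtains y where "\<And>a. a \<in> A \<Longrightarrow> y \<bullet> a \<noteq> 0" "positive_set A R = {a \<in> A. 0 < y \<bullet> a}"
proof -
  obtain C where C: "C \<in> components (- \<Union>(arrangement A))" "R = closure C"
    using assms by (auto simp: regions_def)
  obtain y where "y \<in> C" using in_components_nonempty[OF C(1)] by blast
  moreover have "y \<bullet> a \<noteq> 0" if "a \<in> A" for a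
    using in_components_subset[OF C(1)] that \<open>y \<in> C\<close> by (auto simp: arrangement_def)
  ultimately show thesis using that C positive_set_closure_component by blast
qed

section \<open>Joins of regions and independence of minimal generators\<close>

text \<open>The vector \<open>c\<close> is arbitrary, possibly \<open>0\<close>: it serves as a
  normal of the hyperplane in (1) and as a functional exposing the face in (2).\<close>

lemma lattice_imp_independent_generators:
  fixes A :: "'a::euclidean_space set"
  assumes fin: "finite A" and h: "\<And>a. a \<in> A \<Longrightarrow> 0 < h \<bullet> a"
    and lat: "lattice (poset_of_regions A)"
  obtains B where "B \<subseteq> {a \<in> A. c \<bullet> a = 0}" "independent B"
    "convex_cone hull B = convex_cone hull {a \<in> A. c \<bullet> a = 0}"
    "\<And>b. b \<in> B \<Longrightarrow> b \<notin> convex_cone hull (B - {b})"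
proof -
  let ?Ac = "{a \<in> A. c \<bullet> a = 0}"
  interpret lattice "poset_of_regions A" by (rule lat)
  have finc: "finite ?Ac" using fin by simp
  obtain B where B: "B \<subseteq> ?Ac" "convex_cone hull B = convex_cone hull ?Ac"
    and min: "\<And>b. b \<in> B \<Longrightarrow> b \<notin> convex_cone hull (B - {b})"
    by (rule minimal_cone_generators[OF finc]) blast
  have finB: "finite B" using finite_subset[OF B(1) finc] .
  have "independent B"
  proof (rule ccontr)
    assume "\<not> independent B"
    then obtain u b1 where u: "(\<Sum>b\<in>B. u b *\<^sub>R b) = 0" and b1: "b1 \<in> B" "u b1 \<noteq> 0"
      using dependent_finite[OF finB] by auto
    define I where "I = {b \<in> B. 0 < u b}"
    define J where "J = {b \<in> B. u b < 0}"
    have hB: "0 < h \<bullet> b" if "b \<in> B" for b using h B that by auto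
    obtain w where w_all: "\<forall>b\<in>B. w b \<bullet> b = 0 \<and> (\<forall>b'\<in>B. b' \<noteq> b \<longrightarrow> 0 < w b \<bullet> b') \<and>
        (\<forall>x\<in>convex_cone hull B. 0 \<le> w b \<bullet> x \<and> (w b \<bullet> x = 0 \<longrightarrow> (\<exists>k\<ge>0. x = k *\<^sub>R b)))"
      by (rule extreme_ray_functionals[OF finB hB min])
    have w: "w b \<bullet> b = 0" if "b \<in> B" for b using w_all that by blast
    have w': "0 < w b \<bullet> b'" if "b \<in> B" "b' \<in> B" "b' \<noteq> b" for b b' using w_all that by blast
    have wcone: "0 \<le> w b \<bullet> x" if "b \<in> B" "x \<in> convex_cone hull B" for b x
      using w_all that by blast
    have wray: "\<exists>k\<ge>0. x = k *\<^sub>R b" if "b \<in> B" "x \<in> convex_cone hull B" "w b \<bullet> x = 0" for b x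
      using w_all that by blast
    have cone: "a \<in> convex_cone hull B" if "a \<in> ?Ac" for a
      using that B(2) hull_inc[of a ?Ac convex_cone] by simp
    have wpos: "0 \<le> w b \<bullet> a" if "a \<in> ?Ac" "b \<in> B" for a b
      by (rule wcone[OF that(2) cone[OF that(1)]])
    have wzero: "\<exists>k>0. a = k *\<^sub>R b" if "a \<in> ?Ac" "b \<in> B" "w b \<bullet> a = 0" for a b
    proof -
      obtain k where k: "0 \<le> k" "a = k *\<^sub>R b"
        using wray[OF \<open>b \<in> B\<close> cone[OF \<open>a \<in> ?Ac\<close>] \<open>w b \<bullet> a = 0\<close>] by blast
      moreover have "0 < h \<bullet> a" using h that by simp
      ultimately have "k \<noteq> 0" by auto
      then show ?thesis using k by (metis less_eq_real_def)
    qed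
    \<comment> \<open>Signs are decided in the order \<open>c\<close>, \<open>v\<close>,
      \<open>v'\<close> by two nested perturbations. The last tie-breaker, \<open>h\<close> or
      \<open>- h\<close>, vanishes nowhere on \<open>A\<close>, so the resulting point is
      generic.\<close>
    have region: "\<exists>R. R \<in> regions A \<and> positive_set A R = {a \<in> A. 0 < c \<bullet> a \<or>
        c \<bullet> a = 0 \<and> (0 < v \<bullet> a \<or> v \<bullet> a = 0 \<and> 0 < v' \<bullet> a)}" if v': "v' = h \<or> v' = - h" for v v'
    proof -
      have v': "v' \<bullet> a \<noteq> 0" if "a \<in> A" for a using v' h[OF that] by auto
      obtain z where z: "\<And>a. a \<in> A \<Longrightarrow> sgn (z \<bullet> a) = (if v \<bullet> a = 0 then sgn (v' \<bullet> a) else sgn (v \<bullet> a))"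
        using lexicographic_perturbation[OF fin] by metis
      obtain y where y: "\<And>a. a \<in> A \<Longrightarrow> sgn (y \<bullet> a) = (if c \<bullet> a = 0 then sgn (z \<bullet> a) else sgn (c \<bullet> a))"
        using lexicographic_perturbation[OF fin] by metis
      have "y \<bullet> a \<noteq> 0" if "a \<in> A" for a
        using y[OF that] z[OF that] v'[OF that] by (auto simp: sgn_zero_iff split: if_splits)
      then obtain R where R: "R \<in> regions A" "positive_set A R = {a \<in> A. 0 < y \<bullet> a}"
        using region_of_generic by metis
      have "0 < y \<bullet> a \<longleftrightarrow> 0 < c \<bullet> a \<or> c \<bullet> a = 0 \<and> (0 < v \<bullet> a \<or> v \<bullet> a = 0 \<and> 0 < v' \<bullet> a)"
        if "a \<in> A" for a
        using y[OF that] z[OF that] by (smt (verit) sgn_greater)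
      then show ?thesis using R by blast
    qed
    \<comment> \<open>For \<open>b\<close> in \<open>B\<close> and vectors of \<open>A\<close>
      orthogonal to \<open>c\<close>, \<open>- w b\<close> is zero on the ray of \<open>b\<close>
      and negative off it; with the tie-breaker \<open>h\<close>, just that ray becomes
      positive.\<close>
    have "\<forall>b. \<exists>R. R \<in> regions A \<and> positive_set A R = {a \<in> A. 0 < c \<bullet> a \<or>
        c \<bullet> a = 0 \<and> (0 < (- w b) \<bullet> a \<or> (- w b) \<bullet> a = 0 \<and> 0 < h \<bullet> a)}"
      by (intro allI region) simp
    from choice[OF this] obtain L where L: "\<And>b. L b \<in> regions A"
      "\<And>b. positive_set A (L b) = {a \<in> A. 0 < c \<bullet> a \<or>
        c \<bullet> a = 0 \<and> (0 < (- w b) \<bullet> a \<or> (- w b) \<bullet> a = 0 \<and> 0 < h \<bullet> a)}"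
      by blast
    \<comment> \<open>The opposite choice: among the same vectors, just the ray of \<open>b\<close>
      is negative.\<close>
    have "\<forall>b. \<exists>R. R \<in> regions A \<and> positive_set A R = {a \<in> A. 0 < c \<bullet> a \<or>
        c \<bullet> a = 0 \<and> (0 < w b \<bullet> a \<or> w b \<bullet> a = 0 \<and> 0 < (- h) \<bullet> a)}"
      by (intro allI region) simp
    from choice[OF this] obtain U where U: "\<And>b. U b \<in> regions A"
      "\<And>b. positive_set A (U b) = {a \<in> A. 0 < c \<bullet> a \<or>
        c \<bullet> a = 0 \<and> (0 < w b \<bullet> a \<or> w b \<bullet> a = 0 \<and> 0 < (- h) \<bullet> a)}"
      by blast
    \<comment> \<open>Vectors not orthogonal to \<open>c\<close> have the same sign in both regions.
      Among the others only multiples of \<open>i\<close> are positive for \<open>L i\<close>, and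
      \<open>w j\<close> is positive on them because \<open>i \<noteq> j\<close>.\<close>
    have le: "positive_set A (L i) \<subseteq> positive_set A (U j)" if "i \<in> B" "j \<in> B" "i \<noteq> j" for i j
    proof
      fix a assume a: "a \<in> positive_set A (L i)"
      show "a \<in> positive_set A (U j)"
      proof (cases "a \<in> ?Ac")
        case True
        then have "w i \<bullet> a = 0" using a wpos[OF True \<open>i \<in> B\<close>] by (auto simp: L(2))
        then obtain k where "0 < k" "a = k *\<^sub>R i" using wzero[OF True \<open>i \<in> B\<close>] by blast
        then have "0 < w j \<bullet> a" using w'[of j i] that by simp
        then show ?thesis using True by (auto simp: U(2))
      qed (use a in \<open>auto simp: L(2) U(2)\<close>)
    qed
    have hu: "(\<Sum>b\<in>B. u b * (h \<bullet> b)) = 0"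
      using arg_cong[OF u, of "\<lambda>x. h \<bullet> x"] by (simp add: inner_sum_right)
    \<comment> \<open>The join below is taken over a non-empty family. If no coefficient were
      positive, pairing the relation with \<open>h\<close> would force
      \<open>u b1 = 0\<close>.\<close>
    have "I \<noteq> {}"
    proof
      assume "I = {}"
      then have "\<And>b. b \<in> B \<Longrightarrow> 0 \<le> - u b * (h \<bullet> b)"
        using hB by (fastforce simp: I_def mult_le_0_iff)
      moreover have "(\<Sum>b\<in>B. - u b * (h \<bullet> b)) = 0" using hu by (simp add: sum_negf)
      ultimately have "- u b1 * (h \<bullet> b1) = 0"
        using sum_nonneg_eq_0_iff[OF finB, of "\<lambda>b. - u b * (h \<bullet> b)"] b1 by blast
      then show False using b1 hB[of b1] by simp
    qed
    have finI: "finite (L ` I)" using finB by (simp add: I_def)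
    have join: "least (poset_of_regions A) (\<Squnion>\<^bsub>poset_of_regions A\<^esub> (L ` I)) (Upper (poset_of_regions A) (L ` I))"
      by (rule finite_sup_least[OF finI]) (use \<open>I \<noteq> {}\<close> L(1) in \<open>auto simp: poset_of_regions_def\<close>)
    define R where "R = \<Squnion>\<^bsub>poset_of_regions A\<^esub> (L ` I)"
    have RA: "R \<in> regions A" and R_upper: "\<And>i. i \<in> I \<Longrightarrow> positive_set A (L i) \<subseteq> positive_set A R"
      using join L(1) unfolding R_def[symmetric]
      by (auto simp: least_def Upper_def poset_of_regions_def)
    have R_least: "positive_set A R \<subseteq> positive_set A S"
      if "S \<in> regions A" "\<And>i. i \<in> I \<Longrightarrow> positive_set A (L i) \<subseteq> positive_set A S" for S
    proof -
      have "S \<in> Upper (poset_of_regions A) (L ` I)"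
        using that by (auto simp: Upper_def poset_of_regions_def)
      then show ?thesis
        using join unfolding R_def[symmetric] by (auto simp: least_def poset_of_regions_def)
    qed
    obtain y where y: "\<And>a. a \<in> A \<Longrightarrow> y \<bullet> a \<noteq> 0" "positive_set A R = {a \<in> A. 0 < y \<bullet> a}"
      using generic_of_region[OF RA] by metis
    have "0 < y \<bullet> i" if "i \<in> I" for i
    proof -
      have "i \<in> B" using that by (simp add: I_def)
      then have "i \<in> positive_set A (L i)" using w hB B by (auto simp: L(2))
      then show ?thesis using R_upper[OF that] y(2) by auto
    qed
    \<comment> \<open>\<open>U j\<close> is an upper bound of the \<open>L i\<close>, so the join
      lies below it; \<open>j\<close> is not positive for \<open>U j\<close>, hence not for the
      join.\<close>
    moreover have "y \<bullet> j < 0" if "j \<in> J" for j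
    proof -
      have j: "j \<in> B" "\<And>i. i \<in> I \<Longrightarrow> i \<in> B \<and> i \<noteq> j" using that by (auto simp: I_def J_def)
      then have "positive_set A R \<subseteq> positive_set A (U j)" using R_least[OF U(1)] le by blast
      moreover have "j \<notin> positive_set A (U j)" using w hB[of j] j B by (auto simp: U(2))
      ultimately have "\<not> 0 < y \<bullet> j" using y(2) B j by auto
      then show ?thesis using y(1)[of j] B j by force
    qed
    \<comment> \<open>Wherever \<open>u\<close> is non-zero, \<open>y\<close> now has the same sign.
      Pairing the relation with \<open>y\<close> thus gives nonnegative terms, positive at
      \<open>b1\<close>, although their sum is \<open>0\<close>.\<close>
    ultimately have nn: "0 \<le> u b * (y \<bullet> b)" "b = b1 \<Longrightarrow> 0 < u b * (y \<bullet> b)" if "b \<in> B" for b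
      using that b1 by (cases "0 < u b"; cases "u b < 0"; force simp: I_def J_def mult_neg_neg zero_le_mult_iff)+
    have "0 < (\<Sum>b\<in>B. u b * (y \<bullet> b))"
      using sum_pos2[OF finB b1(1), of "\<lambda>b. u b * (y \<bullet> b)"] nn b1 by blast
    moreover have "(\<Sum>b\<in>B. u b * (y \<bullet> b)) = 0"
      using arg_cong[OF u, of "\<lambda>x. y \<bullet> x"] by (simp add: inner_sum_right)
    ultimately show False by simp
  qed
  then show thesis using that B min by blast
qed


section \<open>Dimension and edges of a polytope at the apex of a cone\<close>

text \<open>The differences \<open>x - s\<close> and the vectors of \<open>V\<close> span the same
  subspace, each \<open>v\<close> being a rescaled difference.\<close>

lemma aff_dim_eq_dim_directions:
  fixes S :: "'a::euclidean_space set"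
  assumes "s \<in> S" "\<And>x. x \<in> S \<Longrightarrow> x - s \<in> span V" "0 < r" "\<And>v. v \<in> V \<Longrightarrow> s + r *\<^sub>R v \<in> S"
  shows "aff_dim S = int (dim V)"
proof -
  have "v \<in> span ((\<lambda>x. x - s) ` S)" if "v \<in> V" for v
  proof -
    have "r *\<^sub>R v \<in> (\<lambda>x. x - s) ` S"
      using assms(4)[OF that] by (intro image_eqI[of _ _ "s + r *\<^sub>R v"]) auto
    then have "(1 / r) *\<^sub>R (r *\<^sub>R v) \<in> span ((\<lambda>x. x - s) ` S)"
      by (intro span_scale span_base)
    then show ?thesis using \<open>0 < r\<close> by simp
  qed
  then have "span ((\<lambda>x. x - s) ` S) = span V"
    using assms(2) by (intro span_eq[THEN iffD2]) auto
  then have "dim ((\<lambda>x. x - s) ` S) = dim V" by (rule span_eq_dim)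
  then show ?thesis using aff_dim_eq_dim_subtract[of s S] assms(1) by (simp add: hull_inc)
qed

text \<open>The cone of \<open>B\<close> bounds \<open>S\<close> at \<open>s\<close> from outside,
  the points \<open>s + r *\<^sub>R b\<close> from inside. Edges at \<open>s\<close> therefore match
  the extreme rays, one for each irredundant generator.\<close>

lemma card_edges_at_apex:
  fixes S :: "'a::euclidean_space set"
  assumes poly: "polytope S" and s: "s \<in> S"
    and fin: "finite B" and h: "\<And>b. b \<in> B \<Longrightarrow> 0 < h \<bullet> b"
    and min: "\<And>b. b \<in> B \<Longrightarrow> b \<notin> convex_cone hull (B - {b})"
    and r: "0 < r" "\<And>b. b \<in> B \<Longrightarrow> s + r *\<^sub>R b \<in> S"
    and cone: "\<And>x. x \<in> S \<Longrightarrow> x - s \<in> convex_cone hull B"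
  shows "card {e. e edge_of S \<and> s \<in> e} = card B"
proof -
  obtain w where w_all: "\<forall>b\<in>B. w b \<bullet> b = 0 \<and> (\<forall>b'\<in>B. b' \<noteq> b \<longrightarrow> 0 < w b \<bullet> b') \<and>
      (\<forall>x\<in>convex_cone hull B. 0 \<le> w b \<bullet> x \<and> (w b \<bullet> x = 0 \<longrightarrow> (\<exists>k\<ge>0. x = k *\<^sub>R b)))"
    by (rule extreme_ray_functionals[OF fin h min])
  have w: "w b \<bullet> b = 0" if "b \<in> B" for b using w_all that by blast
  have w': "0 < w b \<bullet> b'" if "b \<in> B" "b' \<in> B" "b' \<noteq> b" for b b' using w_all that by blast
  have wcone: "0 \<le> w b \<bullet> x" if "b \<in> B" "x \<in> convex_cone hull B" for b x
    using w_all that by blast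
  have wray: "\<exists>k\<ge>0. x = k *\<^sub>R b" if "b \<in> B" "x \<in> convex_cone hull B" "w b \<bullet> x = 0" for b x
    using w_all that by blast
  \<comment> \<open>\<open>G b\<close> is the face minimizing \<open>w b\<close>; as
    \<open>w b\<close> vanishes in the cone only on the ray of \<open>b\<close>, it is the edge
    leaving \<open>s\<close> along \<open>b\<close>.\<close>
  define G where "G = (\<lambda>b. S \<inter> {x. w b \<bullet> x = w b \<bullet> s})"
  have G: "G b face_of S" "s \<in> G b" "s + r *\<^sub>R b \<in> G b" "aff_dim (G b) = 1" if "b \<in> B" for b
  proof -
    show "G b face_of S"
      unfolding G_def
    proof (rule face_of_Int_supporting_hyperplane_ge)
      show "w b \<bullet> x \<ge> w b \<bullet> s" if "x \<in> S" for x
        using wcone[OF \<open>b \<in> B\<close> cone[OF that]] by (simp add: inner_diff_right)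
    qed (use poly polytope_imp_convex in blast)
    show *: "s \<in> G b" "s + r *\<^sub>R b \<in> G b"
      using s r(2) w that by (auto simp: G_def inner_add_right)
    have "x - s \<in> span {b}" if "x \<in> G b" for x
    proof -
      have "\<exists>k\<ge>0. x - s = k *\<^sub>R b"
        using that by (intro wray \<open>b \<in> B\<close> cone) (auto simp: G_def inner_diff_right)
      then show ?thesis by (auto simp: span_singleton)
    qed
    then have "aff_dim (G b) = int (dim {b})"
      using * r by (intro aff_dim_eq_dim_directions) auto
    then show "aff_dim (G b) = 1" using h[OF that] by (auto simp: dim_singleton)
  qed
  have "inj_on G B"
  proof (rule inj_onI, rule ccontr)
    fix b b' assume b: "b \<in> B" "b' \<in> B" "G b = G b'" "b \<noteq> b'"
    then have "w b' \<bullet> (r *\<^sub>R b) = 0" using G(3)[of b] by (auto simp: G_def inner_add_right)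
    then show False using w'[of b' b] b r by simp
  qed
  moreover have "G ` B = {e. e edge_of S \<and> s \<in> e}"
  proof (intro equalityI subsetI)
    fix e assume "e \<in> G ` B"
    then show "e \<in> {e. e edge_of S \<and> s \<in> e}" using G by (auto simp: edge_of_def)
  next
    fix e assume "e \<in> {e. e edge_of S \<and> s \<in> e}"
    then have e: "e face_of S" "aff_dim e = 1" "s \<in> e" by (auto simp: edge_of_def)
    have "e exposed_face_of S"
      using e(1) exposed_face_of_polyhedron[OF polytope_imp_polyhedron[OF poly]] by simp
    then obtain z m where z: "S \<subseteq> {x. z \<bullet> x \<le> m}" "e = S \<inter> {x. z \<bullet> x = m}"
      by (auto simp: exposed_face_of_def)
    have "e \<noteq> {s}" using e(2) by auto
    then obtain p where p: "p \<in> e" "p \<noteq> s" using e(3) by blast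
    then have "p - s \<in> convex_cone hull B" using cone z(2) by auto
    then obtain t where t: "\<forall>b\<in>B. 0 \<le> t b" "p - s = (\<Sum>b\<in>B. t b *\<^sub>R b)"
      using convex_cone_hull_finite_sum[OF fin] by blast
    \<comment> \<open>Every generator points from \<open>s\<close> into \<open>S\<close>, so
      \<open>z\<close> cannot increase along it. As \<open>z\<close> vanishes on
      \<open>p - s\<close>, it vanishes on each generator with non-zero coefficient there.\<close>
    have zb: "z \<bullet> b \<le> 0" if "b \<in> B" for b
    proof -
      have "z \<bullet> (s + r *\<^sub>R b) \<le> z \<bullet> s" using z r(2)[OF that] e(3) by auto
      then show ?thesis using r(1) by (simp add: inner_add_right mult_le_0_iff)
    qed
    have "(\<Sum>b\<in>B. t b * (z \<bullet> b)) = z \<bullet> (p - s)" by (simp add: t inner_sum_right)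
    also have "\<dots> = 0" using z(2) p(1) e(3) by (simp add: inner_diff_right)
    finally have "(\<Sum>b\<in>B. - (t b * (z \<bullet> b))) = 0" by (simp add: sum_negf)
    then have tz: "t b * (z \<bullet> b) = 0" if "b \<in> B" for b
      using sum_nonneg_eq_0_iff[OF fin, of "\<lambda>b. - (t b * (z \<bullet> b))"] that t(1) zb
      by (simp add: mult_nonneg_nonpos)
    obtain b where b: "b \<in> B" "t b \<noteq> 0"
      using p(2) t(2) by (metis (no_types, lifting) eq_iff_diff_eq_0 scaleR_zero_left sum.neutral)
    then have "s + r *\<^sub>R b \<in> e"
      using tz[OF b(1)] z(2) r(2) e(3) by (simp add: inner_add_right)
    \<comment> \<open>The edge contains \<open>s\<close> and \<open>s + r *\<^sub>R b\<close>, so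
      its one-dimensional direction space is the line of \<open>b\<close>, on which
      \<open>w b\<close> is \<open>0\<close>.\<close>
    have "e \<subseteq> G b"
    proof
      fix x assume x: "x \<in> e"
      let ?D = "(\<lambda>x. x - s) ` e"
      have "dim ?D = 1" using aff_dim_eq_dim_subtract[of s e] e by (simp add: hull_inc)
      have "r *\<^sub>R b \<in> ?D"
        using \<open>s + r *\<^sub>R b \<in> e\<close> by (intro image_eqI[of _ _ "s + r *\<^sub>R b"]) auto
      then have "span {r *\<^sub>R b} \<subseteq> span ?D" by (intro span_mono) auto
      moreover have "dim (span {r *\<^sub>R b}) = 1" using h[OF b(1)] r(1) by (auto simp: dim_singleton)
      ultimately have "span {r *\<^sub>R b} = span ?D"
        using \<open>dim ?D = 1\<close> by (intro subspace_dim_equal) auto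
      then have "x - s \<in> span {r *\<^sub>R b}" using x by (simp add: span_base)
      then have "w b \<bullet> (x - s) = 0" using w[OF b(1)] by (auto simp: span_singleton)
      then show "x \<in> G b" using x z(2) by (auto simp: G_def inner_diff_right)
    qed
    then have "e face_of G b"
      using face_of_subset[OF e(1)] by (simp add: G_def)
    then have "e = G b"
      using face_of_aff_dim_lt[of "G b" e] G[OF b(1)] e(2) face_of_imp_convex by force
    then show "e \<in> G ` B" using b(1) by blast
  qed
  ultimately show ?thesis by (metis card_image)
qed

section \<open>Faces and vertices of the zonotope\<close>

lemma zonotope_altdef:
  assumes "finite A"
  shows "zonotope A = {\<Sum>a\<in>A. t a *\<^sub>R a | t. \<forall>a\<in>A. \<bar>t a\<bar> \<le> 1}"
proof -
  have seg: "closed_segment (- a) a = {t *\<^sub>R a | t. \<bar>t\<bar> \<le> 1}" for a :: 'a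
  proof -
    have comb: "(1 - u) *\<^sub>R (- a) + u *\<^sub>R a = (2 * u - 1) *\<^sub>R a" for u
      by (simp add: algebra_simps flip: scaleR_add_left)
    show ?thesis
    proof (intro equalityI subsetI)
      fix x assume "x \<in> closed_segment (- a) a"
      then obtain u where "0 \<le> u" "u \<le> 1" "x = (2 * u - 1) *\<^sub>R a"
        unfolding closed_segment_def comb by blast
      then show "x \<in> {t *\<^sub>R a | t. \<bar>t\<bar> \<le> 1}"
        by (intro CollectI exI[of _ "2 * u - 1"]) auto
    next
      fix x assume "x \<in> {t *\<^sub>R a | t. \<bar>t\<bar> \<le> 1}"
      then obtain t where "\<bar>t\<bar> \<le> 1" "x = t *\<^sub>R a" by auto
      then show "x \<in> closed_segment (- a) a"
        unfolding closed_segment_def comb by (intro CollectI exI[of _ "(1 + t) / 2"]) (auto simp: field_simps)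
    qed
  qed
  show ?thesis
    unfolding zonotope_def set_sum_alt[OF assms]
  proof (intro equalityI subsetI)
    fix x assume "x \<in> {sum s A |s. \<forall>a\<in>A. s a \<in> closed_segment (- a) a}"
    then obtain s where s: "x = sum s A" "\<forall>a\<in>A. \<exists>t. s a = t *\<^sub>R a \<and> \<bar>t\<bar> \<le> 1"
      by (auto simp: seg)
    from bchoice[OF s(2)] obtain t where "\<forall>a\<in>A. s a = t a *\<^sub>R a \<and> \<bar>t a\<bar> \<le> 1" by blast
    then show "x \<in> {\<Sum>a\<in>A. t a *\<^sub>R a | t. \<forall>a\<in>A. \<bar>t a\<bar> \<le> 1}"
      using s(1) by (intro CollectI exI[of _ t]) auto
  next
    fix x assume "x \<in> {\<Sum>a\<in>A. t a *\<^sub>R a | t. \<forall>a\<in>A. \<bar>t a\<bar> \<le> 1}"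
    then show "x \<in> {sum s A |s. \<forall>a\<in>A. s a \<in> closed_segment (- a) a}"
      by (auto simp: seg)
  qed
qed

lemma polytope_zonotope: "polytope (zonotope A)"
proof -
  have "zonotope A = convex hull (\<Sum>a\<in>A. {- a, a})"
    by (simp add: zonotope_def convex_hull_set_sum segment_convex_hull)
  then show ?thesis
    by (simp add: polytope_convex_hull finite_set_sum)
qed

text \<open>The comparison holds term by term. So the sum of the absolute values is the support
  function of the zonotope, and a maximizer of \<open>c\<close> has free coefficients only at
  vectors orthogonal to \<open>c\<close>.\<close>

lemma inner_zonotope_point:
  fixes A :: "'a::euclidean_space set"
  assumes "finite A" "\<And>a. a \<in> A \<Longrightarrow> \<bar>t a\<bar> \<le> 1"
  shows inner_zonotope_point_le: "c \<bullet> (\<Sum>a\<in>A. t a *\<^sub>R a) \<le> (\<Sum>a\<in>A. \<bar>c \<bullet> a\<bar>)"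
    and inner_zonotope_point_eq_iff: "c \<bullet> (\<Sum>a\<in>A. t a *\<^sub>R a) = (\<Sum>a\<in>A. \<bar>c \<bullet> a\<bar>) \<longleftrightarrow>
      (\<forall>a\<in>A. c \<bullet> a \<noteq> 0 \<longrightarrow> t a = sgn (c \<bullet> a))"
proof -
  have nn: "0 \<le> \<bar>c \<bullet> a\<bar> - t a * (c \<bullet> a)" if "a \<in> A" for a
  proof -
    have "t a * (c \<bullet> a) \<le> \<bar>t a\<bar> * \<bar>c \<bullet> a\<bar>" by (metis abs_ge_self abs_mult)
    also have "\<dots> \<le> \<bar>c \<bullet> a\<bar>" using assms(2)[OF that] by (simp add: mult_left_le_one_le)
    finally show ?thesis by simp
  qed
  have diff: "(\<Sum>a\<in>A. \<bar>c \<bullet> a\<bar> - t a * (c \<bullet> a)) = (\<Sum>a\<in>A. \<bar>c \<bullet> a\<bar>) - c \<bullet> (\<Sum>a\<in>A. t a *\<^sub>R a)"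
    by (simp add: sum_subtractf inner_sum_right)
  show "c \<bullet> (\<Sum>a\<in>A. t a *\<^sub>R a) \<le> (\<Sum>a\<in>A. \<bar>c \<bullet> a\<bar>)"
    using sum_nonneg[of A "\<lambda>a. \<bar>c \<bullet> a\<bar> - t a * (c \<bullet> a)"] nn diff by simp
  have "c \<bullet> (\<Sum>a\<in>A. t a *\<^sub>R a) = (\<Sum>a\<in>A. \<bar>c \<bullet> a\<bar>) \<longleftrightarrow> (\<Sum>a\<in>A. \<bar>c \<bullet> a\<bar> - t a * (c \<bullet> a)) = 0"
    using diff by auto
  also have "\<dots> \<longleftrightarrow> (\<forall>a\<in>A. \<bar>c \<bullet> a\<bar> - t a * (c \<bullet> a) = 0)"
    using sum_nonneg_eq_0_iff[OF assms(1), of "\<lambda>a. \<bar>c \<bullet> a\<bar> - t a * (c \<bullet> a)"] nn by simp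
  also have "\<dots> \<longleftrightarrow> (\<forall>a\<in>A. c \<bullet> a \<noteq> 0 \<longrightarrow> t a = sgn (c \<bullet> a))"
  proof -
    have "\<bar>x\<bar> - k * x = (sgn x - k) * x" for x k :: real
      by (simp add: abs_sgn algebra_simps)
    then show ?thesis by auto
  qed
  finally show "c \<bullet> (\<Sum>a\<in>A. t a *\<^sub>R a) = (\<Sum>a\<in>A. \<bar>c \<bullet> a\<bar>) \<longleftrightarrow>
      (\<forall>a\<in>A. c \<bullet> a \<noteq> 0 \<longrightarrow> t a = sgn (c \<bullet> a))" .
qed

text \<open>Faces of a polytope are exposed, and the point with coefficients
  \<open>sgn (c \<bullet> a)\<close> attains the bound on \<open>c\<close>, which fixes the level
  \<open>m\<close>.\<close>

lemma face_of_zonotope: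
  assumes fin: "finite A" and F: "F face_of zonotope A" "F \<noteq> {}"
  obtains c where "F = {x \<in> zonotope A. c \<bullet> x = (\<Sum>a\<in>A. \<bar>c \<bullet> a\<bar>)}"
proof -
  have "F exposed_face_of zonotope A"
    using F exposed_face_of_polyhedron[OF polytope_imp_polyhedron[OF polytope_zonotope]] by blast
  then obtain c m where c: "zonotope A \<subseteq> {x. c \<bullet> x \<le> m}" "F = zonotope A \<inter> {x. c \<bullet> x = m}"
    by (auto simp: exposed_face_of_def)
  have "(\<Sum>a\<in>A. sgn (c \<bullet> a) *\<^sub>R a) \<in> zonotope A"
    using fin by (auto simp: zonotope_altdef abs_sgn_eq intro!: exI[of _ "\<lambda>a. sgn (c \<bullet> a)"])
  moreover have "c \<bullet> (\<Sum>a\<in>A. sgn (c \<bullet> a) *\<^sub>R a) = (\<Sum>a\<in>A. \<bar>c \<bullet> a\<bar>)"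
    by (subst inner_zonotope_point_eq_iff[OF fin]) (auto simp: abs_sgn_eq)
  ultimately have "(\<Sum>a\<in>A. \<bar>c \<bullet> a\<bar>) \<le> m" using c(1) by fastforce
  moreover have "m \<le> (\<Sum>a\<in>A. \<bar>c \<bullet> a\<bar>)"
  proof -
    obtain x where "x \<in> zonotope A" "c \<bullet> x = m" using c(2) F(2) by auto
    then show ?thesis using fin by (auto simp: zonotope_altdef intro: inner_zonotope_point_le)
  qed
  ultimately show thesis using that[of c] c(2) by auto
qed

text \<open>A functional exposing a vertex is generic, so its signs are the coefficients of the
  vertex. They also tell on which side of each hyperplane the normal cone lies, which links vertices
  to positive sets.\<close>

lemma vertex_of_zonotope:
  fixes A :: "'a::euclidean_space set"
  assumes fin: "finite A" and nz: "0 \<notin> A" and v: "v extreme_point_of zonotope A"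
  obtains c where "\<And>a. a \<in> A \<Longrightarrow> c \<bullet> a \<noteq> 0" "c \<bullet> v = (\<Sum>a\<in>A. \<bar>c \<bullet> a\<bar>)"
    "v = (\<Sum>a\<in>A. sgn (c \<bullet> a) *\<^sub>R a)"
    "positive_set A (normal_cone (zonotope A) v) = {a \<in> A. 0 < c \<bullet> a}"
proof -
  have "{v} face_of zonotope A" using v by (simp add: face_of_singleton)
  then obtain c where c: "{v} = {x \<in> zonotope A. c \<bullet> x = (\<Sum>a\<in>A. \<bar>c \<bullet> a\<bar>)}"
    using face_of_zonotope[OF fin] by blast
  then have cv: "c \<bullet> v = (\<Sum>a\<in>A. \<bar>c \<bullet> a\<bar>)" by blast
  have veq: "(\<Sum>a\<in>A. t a *\<^sub>R a) = v"
    if "\<And>a. a \<in> A \<Longrightarrow> \<bar>t a\<bar> \<le> 1" "\<And>a. a \<in> A \<Longrightarrow> c \<bullet> a \<noteq> 0 \<Longrightarrow> t a = sgn (c \<bullet> a)" for t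
  proof -
    have "(\<Sum>a\<in>A. t a *\<^sub>R a) \<in> zonotope A" using that fin by (auto simp: zonotope_altdef)
    moreover have "c \<bullet> (\<Sum>a\<in>A. t a *\<^sub>R a) = (\<Sum>a\<in>A. \<bar>c \<bullet> a\<bar>)"
      using that inner_zonotope_point_eq_iff[OF fin, of t c] by blast
    ultimately show ?thesis using c by blast
  qed
  define u where "u = (\<lambda>a. sgn (c \<bullet> a))"
  have u1: "\<bar>u a\<bar> \<le> 1" for a by (simp add: u_def abs_sgn_eq)
  have vu: "v = (\<Sum>a\<in>A. u a *\<^sub>R a)" using veq[of u] u1 by (simp add: u_def)
  have upd: "(\<Sum>a\<in>A. (u(a0 := k)) a *\<^sub>R a) = v + (k - u a0) *\<^sub>R a0" if "a0 \<in> A" for a0 k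
    using sum.remove[OF fin that, of "\<lambda>a. (u(a0 := k)) a *\<^sub>R a"] sum.remove[OF fin that, of "\<lambda>a. u a *\<^sub>R a"]
    by (simp add: vu algebra_simps)
  have c0: "c \<bullet> a0 \<noteq> 0" if "a0 \<in> A" for a0
  proof
    assume "c \<bullet> a0 = 0"
    \<comment> \<open>Here \<open>u a0 = 0\<close>; raising it to \<open>1\<close> moves the point
      by \<open>a0\<close> while it still maximizes \<open>c\<close>, but \<open>v\<close> is the
      only maximizer.\<close>
    then have "(\<Sum>a\<in>A. (u(a0 := 1)) a *\<^sub>R a) = v"
      using u1 by (intro veq) (auto simp: u_def)
    then have "a0 = 0" using upd[OF that, of 1] \<open>c \<bullet> a0 = 0\<close> by (simp add: u_def)
    then show False using that nz by simp
  qed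
  \<comment> \<open>Flipping the coefficient of \<open>a0\<close> stays in the zonotope and moves
    \<open>v\<close> by \<open>- 2 * u a0\<close> times \<open>a0\<close>; no \<open>y\<close> in
    the normal cone may increase in that direction.\<close>
  have pos: "0 \<le> u a0 * (y \<bullet> a0)" if y: "y \<in> normal_cone (zonotope A) v" and "a0 \<in> A" for y a0
  proof -
    have "v + (- u a0 - u a0) *\<^sub>R a0 \<in> zonotope A"
      unfolding upd[OF \<open>a0 \<in> A\<close>, symmetric] zonotope_altdef[OF fin]
      using u1 by (intro CollectI exI[of _ "u(a0 := - u a0)"]) auto
    then have "y \<bullet> (v + (- u a0 - u a0) *\<^sub>R a0) \<le> y \<bullet> v"
      using y by (simp add: normal_cone_def)
    then show ?thesis by (simp add: inner_add_right inner_diff_right)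
  qed
  have "c \<in> normal_cone (zonotope A) v"
    using inner_zonotope_point_le[OF fin, of _ c] cv fin by (auto simp: normal_cone_def zonotope_altdef)
  have "positive_set A (normal_cone (zonotope A) v) = {a \<in> A. 0 < c \<bullet> a}"
  proof (intro equalityI subsetI)
    fix a assume "a \<in> positive_set A (normal_cone (zonotope A) v)"
    then have "a \<in> A" "0 \<le> c \<bullet> a"
      using \<open>c \<in> normal_cone (zonotope A) v\<close> by (auto simp: positive_set_def)
    then show "a \<in> {a \<in> A. 0 < c \<bullet> a}" using c0[of a] by simp
  next
    fix a assume "a \<in> {a \<in> A. 0 < c \<bullet> a}"
    then show "a \<in> positive_set A (normal_cone (zonotope A) v)"
      using pos[of _ a] by (auto simp: positive_set_def u_def)
  qed
  then show thesis using that[OF c0 cv] vu by (simp add: u_def)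
qed

text \<open>The positive set fixes every sign, zero being excluded, and the signs are the
  coefficients of the vertex. This supplies antisymmetry when vertices are compared.\<close>

lemma vertex_of_zonotope_eqI:
  assumes "finite A" "0 \<notin> A" "v extreme_point_of zonotope A" "w extreme_point_of zonotope A"
    "positive_set A (normal_cone (zonotope A) v) = positive_set A (normal_cone (zonotope A) w)"
  shows "v = w"
proof -
  obtain c where c: "\<And>a. a \<in> A \<Longrightarrow> c \<bullet> a \<noteq> 0" "v = (\<Sum>a\<in>A. sgn (c \<bullet> a) *\<^sub>R a)"
    "positive_set A (normal_cone (zonotope A) v) = {a \<in> A. 0 < c \<bullet> a}"
    by (rule vertex_of_zonotope[OF assms(1-3)]) blast
  obtain d where d: "\<And>a. a \<in> A \<Longrightarrow> d \<bullet> a \<noteq> 0" "w = (\<Sum>a\<in>A. sgn (d \<bullet> a) *\<^sub>R a)"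
    "positive_set A (normal_cone (zonotope A) w) = {a \<in> A. 0 < d \<bullet> a}"
    by (rule vertex_of_zonotope[OF assms(1,2,4)]) blast
  have "sgn (c \<bullet> a) = sgn (d \<bullet> a)" if "a \<in> A" for a
  proof -
    have "0 < c \<bullet> a \<longleftrightarrow> 0 < d \<bullet> a" using assms(5) c(3) d(3) that by blast
    then show ?thesis using c(1)[OF that] d(1)[OF that] by (auto simp: sgn_if)
  qed
  then show ?thesis using c(2) d(2) by simp
qed

section \<open>Sources of faces\<close>

text \<open>On \<open>F\<close> the coefficients at vectors with
  \<open>c \<bullet> a \<noteq> 0\<close> are forced, and \<open>-1\<close> is the least choice at
  the others. The resulting vertex has the least positive set in \<open>F\<close>, so it is the
  unique minimal one.\<close>

lemma source_of_zonotope_face: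
  fixes A :: "'a::euclidean_space set"
  assumes fin: "finite A" and h: "\<And>a. a \<in> A \<Longrightarrow> 0 < h \<bullet> a"
    and face: "F face_of zonotope A"
    and F: "F = {x \<in> zonotope A. c \<bullet> x = (\<Sum>a\<in>A. \<bar>c \<bullet> a\<bar>)}"
  shows "source A F = (\<Sum>a\<in>A. (if 0 < c \<bullet> a then 1 else - 1) *\<^sub>R a)"
proof -
  define t where "t = (\<lambda>a. if 0 < c \<bullet> a then 1 else - 1 :: real)"
  define s where "s = (\<Sum>a\<in>A. t a *\<^sub>R a)"
  let ?N = "normal_cone (zonotope A)" and ?L = "poset_of_regions A"
  have nz: "0 \<notin> A" using h by fastforce
  have t1: "\<bar>t a\<bar> \<le> 1" for a by (simp add: t_def)
  have "s \<in> zonotope A" using t1 fin by (auto simp: s_def zonotope_altdef)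
  moreover have "c \<bullet> s = (\<Sum>a\<in>A. \<bar>c \<bullet> a\<bar>)"
    unfolding s_def by (subst inner_zonotope_point_eq_iff[OF fin t1]) (auto simp: t_def sgn_if)
  ultimately have sF: "s \<in> F" by (simp add: F)
  \<comment> \<open>The coefficients \<open>t\<close> are pointwise least on \<open>F\<close> and
    \<open>h\<close> is positive on \<open>A\<close>, so \<open>h\<close> is minimal over
    \<open>F\<close> only at \<open>s\<close>; this makes \<open>s\<close> a vertex.\<close>
  have hF: "h \<bullet> s \<le> h \<bullet> x" "h \<bullet> x = h \<bullet> s \<Longrightarrow> x = s" if "x \<in> F" for x
  proof -
    obtain t' where t': "x = (\<Sum>a\<in>A. t' a *\<^sub>R a)" "\<And>a. a \<in> A \<Longrightarrow> \<bar>t' a\<bar> \<le> 1"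
      using \<open>x \<in> F\<close> fin by (auto simp: F zonotope_altdef)
    have "t a \<le> t' a" if "a \<in> A" for a
    proof (cases "0 < c \<bullet> a")
      case True
      have "c \<bullet> (\<Sum>a\<in>A. t' a *\<^sub>R a) = (\<Sum>a\<in>A. \<bar>c \<bullet> a\<bar>)" using \<open>x \<in> F\<close> t'(1) by (simp add: F)
      then have "t' a = sgn (c \<bullet> a)"
        using inner_zonotope_point_eq_iff[OF fin t'(2), where c = c] True that by auto
      then show ?thesis using True by (simp add: t_def)
    next
      case False
      then show ?thesis using t'(2)[OF that] by (simp add: t_def)
    qed
    then have nn: "0 \<le> (t' a - t a) * (h \<bullet> a)" if "a \<in> A" for a
      using that h[OF that] by simp
    have diff: "(\<Sum>a\<in>A. (t' a - t a) * (h \<bullet> a)) = h \<bullet> x - h \<bullet> s"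
      by (simp add: t' s_def inner_sum_right sum_subtractf left_diff_distrib)
    then show "h \<bullet> s \<le> h \<bullet> x" using sum_nonneg[of A "\<lambda>a. (t' a - t a) * (h \<bullet> a)"] nn diff by simp
    assume "h \<bullet> x = h \<bullet> s"
    then have "\<forall>a\<in>A. (t' a - t a) * (h \<bullet> a) = 0"
      using diff sum_nonneg_eq_0_iff[OF fin, of "\<lambda>a. (t' a - t a) * (h \<bullet> a)"] nn by simp
    then have "\<forall>a\<in>A. t' a = t a" using h by fastforce
    then show "x = s" by (simp add: t'(1) s_def)
  qed
  have "F \<inter> {x. h \<bullet> x = h \<bullet> s} = {s}" using sF hF(2) by blast
  then have sF': "s extreme_point_of F"
    using extreme_point_of_Int_supporting_hyperplane_ge hF(1) by blast
  have ext: "v extreme_point_of zonotope A" if "v extreme_point_of F" for v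
    using that extreme_point_of_face[OF face] by blast
  obtain d where d: "\<And>a. a \<in> A \<Longrightarrow> d \<bullet> a \<noteq> 0" "d \<bullet> s = (\<Sum>a\<in>A. \<bar>d \<bullet> a\<bar>)"
    "positive_set A (?N s) = {a \<in> A. 0 < d \<bullet> a}"
    by (rule vertex_of_zonotope[OF fin nz ext[OF sF']]) blast
  \<comment> \<open>As \<open>d\<close> is generic, maximizing it forces every coefficient, so
    \<open>t\<close> records the signs of \<open>d\<close>.\<close>
  have td: "t a = sgn (d \<bullet> a)" if "a \<in> A" for a
    using d(1)[OF that] d(2) inner_zonotope_point_eq_iff[OF fin t1, where c = d] that
    by (auto simp: s_def)
  have "positive_set A (?N s) = {a \<in> A. 0 < c \<bullet> a}"
    unfolding d(3) using td by (force simp: t_def sgn_if split: if_splits)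
  moreover have "{a \<in> A. 0 < c \<bullet> a} \<subseteq> positive_set A (?N v)" if v: "v extreme_point_of F" for v
  proof
    fix a assume a: "a \<in> {a \<in> A. 0 < c \<bullet> a}"
    obtain d where d: "v = (\<Sum>a\<in>A. sgn (d \<bullet> a) *\<^sub>R a)" "positive_set A (?N v) = {a \<in> A. 0 < d \<bullet> a}"
      by (rule vertex_of_zonotope[OF fin nz ext[OF v]]) blast
    have "c \<bullet> v = (\<Sum>a\<in>A. \<bar>c \<bullet> a\<bar>)" using v by (auto simp: F extreme_point_of_def)
    moreover have "\<bar>sgn (d \<bullet> a)\<bar> \<le> 1" for a by (simp add: abs_sgn_eq)
    ultimately have "sgn (d \<bullet> a) = sgn (c \<bullet> a)"
      using a inner_zonotope_point_eq_iff[OF fin, of "\<lambda>a. sgn (d \<bullet> a)" c] by (auto simp: d(1))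
    then show "a \<in> positive_set A (?N v)" using a d(2) by (auto simp: sgn_if split: if_splits)
  qed
  ultimately have below: "positive_set A (?N s) \<subseteq> positive_set A (?N v)"
    if "v extreme_point_of F" for v using that by blast
  have eqI: "v = s" if "v extreme_point_of F" "positive_set A (?N v) \<subseteq> positive_set A (?N s)" for v
    using vertex_of_zonotope_eqI[OF fin nz ext ext] below that sF' by blast
  \<comment> \<open>Strictness means that the cones differ, not that their positive sets do. Hence
    minimality first yields equal cones, and \<open>eqI\<close> then yields equal vertices.\<close>
  have less: "?N v \<sqsubset>\<^bsub>?L\<^esub> ?N w \<longleftrightarrow> positive_set A (?N v) \<subseteq> positive_set A (?N w) \<and> ?N v \<noteq> ?N w"
    for v w by (simp add: lless_def poset_of_regions_def)
  have "source A F = s"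
    unfolding source_def
  proof (rule the_equality)
    show "s extreme_point_of F \<and> \<not> (\<exists>w. w extreme_point_of F \<and> ?N w \<sqsubset>\<^bsub>?L\<^esub> ?N s)"
      using sF' eqI less by blast
  next
    fix v assume v: "v extreme_point_of F \<and> \<not> (\<exists>w. w extreme_point_of F \<and> ?N w \<sqsubset>\<^bsub>?L\<^esub> ?N v)"
    then have "?N s = ?N v" using sF' below less by blast
    then show "v = s" using eqI v by simp
  qed
  then show ?thesis by (simp add: s_def t_def)
qed

section \<open>Simplicial cones on hyperplanes and degrees of sources\<close>

lemma convex_cone_hull_sum:
  assumes "\<And>i. i \<in> I \<Longrightarrow> f i \<in> convex_cone hull S"
  shows "sum f I \<in> convex_cone hull S"
  using assms
  by (induction I rule: infinite_finite_induct)
    (auto simp: convex_cone_hull_contains_0 convex_cone_hull_add)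

theorem lemma68:
  fixes A :: "(real ^ 'n) set"
  assumes "finite A"
    and "0 \<notin> A"
    and "in_open_halfspace A"
    and "lattice (poset_of_regions A)"
  shows "(\<forall>H. linear_hyperplane H \<longrightarrow> simplicial_cone (convex_cone hull (A \<inter> H))) \<and>
         (\<forall>F d. F face_of zonotope A \<and> aff_dim F = int d \<longrightarrow> degree_in F (source A F) = d)"
proof (intro conjI allI impI)
  obtain h where h: "\<And>a. a \<in> A \<Longrightarrow> 0 < h \<bullet> a"
    using assms(3) by (auto simp: in_open_halfspace_def inner_commute)
  note gen = lattice_imp_independent_generators[OF assms(1) h assms(4)]
  {
    fix H :: "(real ^ 'n) set"
    assume "linear_hyperplane H"
    then obtain c where "H = {x. x \<bullet> c = 0}" by (auto simp: linear_hyperplane_def)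
    then have "A \<inter> H = {a \<in> A. c \<bullet> a = 0}" by (auto simp: inner_commute)
    then show "simplicial_cone (convex_cone hull (A \<inter> H))"
      unfolding simplicial_cone_def using gen[of c] by metis
  next
    fix F :: "(real ^ 'n) set" and d
    assume F: "F face_of zonotope A \<and> aff_dim F = int d"
    then have "F \<noteq> {}" by auto
    then obtain c where c: "F = {x \<in> zonotope A. c \<bullet> x = (\<Sum>a\<in>A. \<bar>c \<bullet> a\<bar>)}"
      using face_of_zonotope[OF assms(1)] F by blast
    obtain B where B: "B \<subseteq> {a \<in> A. c \<bullet> a = 0}" "independent B"
      "convex_cone hull B = convex_cone hull {a \<in> A. c \<bullet> a = 0}"
      "\<And>b. b \<in> B \<Longrightarrow> b \<notin> convex_cone hull (B - {b})"
      using gen[of c] by blast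
    have finB: "finite B" using B(1) assms(1) by (auto intro: finite_subset)
    define t where "t = (\<lambda>a. if 0 < c \<bullet> a then 1 else - 1 :: real)"
    define s where "s = (\<Sum>a\<in>A. t a *\<^sub>R a)"
    have source: "source A F = s"
      using source_of_zonotope_face[OF assms(1) h _ c] F by (simp add: s_def t_def)
    have inF: "(\<Sum>a\<in>A. t' a *\<^sub>R a) \<in> F \<longleftrightarrow> (\<forall>a\<in>A. c \<bullet> a \<noteq> 0 \<longrightarrow> t' a = sgn (c \<bullet> a))"
      if "\<And>a. a \<in> A \<Longrightarrow> \<bar>t' a\<bar> \<le> 1" for t'
      using inner_zonotope_point_eq_iff[OF assms(1) that, where c = c] that
      by (auto simp: c zonotope_altdef[OF assms(1)])
    have sF: "s \<in> F" unfolding s_def by (subst inF) (auto simp: t_def sgn_if)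
    \<comment> \<open>Turning the coefficient of \<open>b\<close> from \<open>-1\<close> to
      \<open>1\<close> accounts for the step \<open>2\<close>; since \<open>b\<close> is orthogonal
      to \<open>c\<close>, the point stays in \<open>F\<close>.\<close>
    have sb: "s + 2 *\<^sub>R b \<in> F" if "b \<in> B" for b
    proof -
      have b: "b \<in> A" "c \<bullet> b = 0" using that B(1) by auto
      have "(\<Sum>a\<in>A. (t(b := 1)) a *\<^sub>R a) = s + 2 *\<^sub>R b"
        using sum.remove[OF assms(1) b(1), of "\<lambda>a. (t(b := 1)) a *\<^sub>R a"] b(2)
          sum.remove[OF assms(1) b(1), of "\<lambda>a. t a *\<^sub>R a"]
        by (simp add: s_def t_def algebra_simps scaleR_2)
      moreover have "(\<Sum>a\<in>A. (t(b := 1)) a *\<^sub>R a) \<in> F"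
        using b(2) by (subst inF) (auto simp: t_def sgn_if)
      ultimately show ?thesis by simp
    qed
    \<comment> \<open>Compared with \<open>s\<close>, coefficients can change only at vectors
      orthogonal to \<open>c\<close>, where they grow from the minimum \<open>-1\<close>.\<close>
    have cone: "x - s \<in> convex_cone hull B" if "x \<in> F" for x
    proof -
      obtain t' where t': "x = (\<Sum>a\<in>A. t' a *\<^sub>R a)" "\<And>a. a \<in> A \<Longrightarrow> \<bar>t' a\<bar> \<le> 1"
        using \<open>x \<in> F\<close> assms(1) by (auto simp: c zonotope_altdef)
      have "(t' a - t a) *\<^sub>R a \<in> convex_cone hull B" if "a \<in> A" for a
      proof (cases "c \<bullet> a = 0")
        case True
        then have "a \<in> convex_cone hull B" using B(3) that hull_inc[of a "{a \<in> A. c \<bullet> a = 0}" convex_cone] by simp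
        moreover have "0 \<le> t' a - t a" using t'(2)[OF that] True by (auto simp: t_def)
        ultimately show ?thesis by (rule convex_cone_hull_mul)
      next
        case False
        then have "t' a = t a"
          using inF[OF t'(2)] \<open>x \<in> F\<close> t'(1) that by (auto simp: t_def sgn_if)
        then show ?thesis by (simp add: convex_cone_hull_contains_0)
      qed
      then have "(\<Sum>a\<in>A. (t' a - t a) *\<^sub>R a) \<in> convex_cone hull B" by (rule convex_cone_hull_sum)
      then show ?thesis by (simp add: t' s_def scaleR_diff_left sum_subtractf)
    qed
    \<comment> \<open>The dimension of \<open>F\<close> is that of the span of \<open>B\<close>.
      Independence of \<open>B\<close>, obtained from the lattice property, makes it equal to the
      number of generators rather than at most that number.\<close>
    have "convex_cone hull B \<subseteq> span B"
      by (rule hull_minimal) (auto simp: span_base convex_cone_span)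
    then have "aff_dim F = int (dim B)"
      using cone sF sb by (intro aff_dim_eq_dim_directions[of s F B 2]) auto
    also have "dim B = card B" using B(2) by (rule dim_eq_card_independent)
    finally have "card B = d" using F by simp
    moreover have "polytope F" using F polytope_zonotope face_of_polytope_polytope by blast
    then have "card {e. e edge_of F \<and> s \<in> e} = card B"
    proof (rule card_edges_at_apex)
      show "0 < h \<bullet> b" if "b \<in> B" for b using h that B(1) by auto
    qed (use sF finB B(4) sb cone in auto)
    ultimately show "degree_in F (source A F) = d"
      by (simp add: degree_in_def source)
  }
qed

end
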